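(* Let $\bar c\in\mathcal C$ be a null vertex of $\operatorname{conv}(\mathcal C)$, let $H'$ be an affine hyperplane of $\mathcal H$ strictly separating $\bar c$ from $\operatorname{conv}(\frac12(d+\mathcal W))$, let $P:\operatorname{conv}(\frac12(d+\mathcal W))\to H'$ send $\bar z$ to the intersection of the ray from $\bar c$ through $\bar z$ with $H'$, and let $\Delta=P(\operatorname{conv}(\frac12(d+\mathcal W)))$. Let $\bar\xi$ be a vertex of $\Delta$. Then exactly one of the following holds: (1A) $J(\bar c,\bar\xi)=0$ (and hence $P^{-1}(\bar\xi)$ is $J$-orthogonal to $\bar c$); (1B) the line through $\bar c,\bar\xi$ meets $\operatorname{conv}(\frac12(d+\mathcal W))$ in a unique point $\bar x$, and there is a null $\bar a\in\mathcal C$ with $\frac12(\bar a+\bar c)=\bar x$; (2) $J(\bar c,\bar\xi)\neq0$, and $\bar c,\bar\xi$ are collinear with an edge $\bar v\bar w$ of $\operatorname{conv}(\frac12(d+\mathcal W))$ (hence $c=2\bar c-d$ and $\xi=2\bar\xi-d$ are collinear with the corresponding edge $vw$ of $\operatorname{conv}(\mathcal W)$).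
   Context: Setting: $G$ compact Lie group, $K\subset G$ closed, $G/K$ connected almost effective, isotropy representation $\mathfrak p=\mathfrak p_1\oplus\cdots\oplus\mathfrak p_r$ ($r\ge2$) with pairwise inequivalent $\mathbb R$-irreducible summands, $d_i=\dim\mathfrak p_i$, $d=(d_1,\dots,d_r)$, $n=\sum d_i$. The scalar curvature of the metric $e^{q_i}Q$ on $\mathfrak p_i$ is $S(q)=\sum_{w\in\mathcal W}A_we^{w\cdot q}$, $\mathcal W\subset\mathbb Z^r$ finite, $A_w\ne0$, each $w$ of type I (one entry $-1$), type II (one entry $1$, two entries $-1$) or type III (one entry $1$, one entry $-2$), other entries $0$; $A_w>0$ for type I and $<0$ otherwise. Assume $\dim\operatorname{conv}(\mathcal W)=r-1$. $J$ is the symmetric bilinear form on $\mathbb R^r$ with $J(p,p)=\frac1{n-1}(\sum p_i)^2-\sum p_i^2/d_i$; $\bar x$ is null if $J(\bar x,\bar x)=0$. $u=\sum_{\bar c\in\mathcal C}F_{\bar c}e^{\bar c\cdot q}$ ($\mathcal C$ finite, $F_{\bar c}\ne0$) is a superpotential: for every $\xi$, $\sum_{(\bar a,\bar c)\in\mathcal C^2,\ \bar a+\bar c=\xi}J(\bar a,\bar c)F_{\bar a}F_{\bar c}$ equals $A_w$ if $\xi=d+w$, $w\in\mathcal W$, and $0$ otherwise. Normalise so that $\mathcal C$ lies in $\mathcal H=\{\sum\bar x_i=\frac12(n-1)\}$. For $x$ with $\sum x_i=-1$ write $\bar x=\frac12(d+x)\in\mathcal H$, and conversely $x=2\bar x-d$.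 A null vertex of $\operatorname{conv}(\mathcal C)$ lies outside $\operatorname{conv}(\frac12(d+\mathcal W))$. *)

theory Defs
  imports "HOL-Analysis.Analysis"
begin

text \<open>Vectors in R^r are modelled as real^'n with r = CARD('n).
  The vector d = (d_1,...,d_r) of dimensions is a real vector with positive natural entries.\<close>

definition vsum :: "real^'n \<Rightarrow> real" where
  "vsum x = (\<Sum>i\<in>UNIV. x $ i)"

definition ntot :: "real^'n \<Rightarrow> real" where
  "ntot d = vsum d"

definition Jform :: "real^'n \<Rightarrow> real^'n \<Rightarrow> real^'n \<Rightarrow> real" where
  "Jform d p q = vsum p * vsum q / (ntot d - 1) - (\<Sum>i\<in>UNIV. p $ i * q $ i / d $ i)"

definition is_null :: "real^'n \<Rightarrow> real^'n \<Rightarrow> bool" where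
  "is_null d x \<longleftrightarrow> Jform d x x = 0"

definition typeI :: "real^'n \<Rightarrow> bool" where
  "typeI w \<longleftrightarrow> (\<exists>i. w $ i = -1 \<and> (\<forall>l. l \<noteq> i \<longrightarrow> w $ l = 0))"

definition typeII :: "real^'n \<Rightarrow> bool" where
  "typeII w \<longleftrightarrow> (\<exists>i j k. i \<noteq> j \<and> i \<noteq> k \<and> j \<noteq> k \<and>
      w $ i = 1 \<and> w $ j = -1 \<and> w $ k = -1 \<and> (\<forall>l. l \<notin> {i,j,k} \<longrightarrow> w $ l = 0))"

definition typeIII :: "real^'n \<Rightarrow> bool" where
  "typeIII w \<longleftrightarrow> (\<exists>i j. i \<noteq> j \<and> w $ i = 1 \<and> w $ j = -2 \<and>
      (\<forall>l. l \<notin> {i,j} \<longrightarrow> w $ l = 0))"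

definition scal_data :: "real^'n \<Rightarrow> (real^'n) set \<Rightarrow> (real^'n \<Rightarrow> real) \<Rightarrow> bool" where
  "scal_data d W A \<longleftrightarrow>
     CARD('n) \<ge> 2 \<and>
     (\<forall>i. d $ i \<in> \<nat> \<and> d $ i \<ge> 1) \<and>
     finite W \<and>
     (\<forall>w\<in>W. A w \<noteq> 0 \<and> (typeI w \<or> typeII w \<or> typeIII w) \<and>
              (typeI w \<longrightarrow> A w > 0) \<and> ((typeII w \<or> typeIII w) \<longrightarrow> A w < 0)) \<and>
     aff_dim (convex hull W) = int CARD('n) - 1"

definition Hplane :: "real^'n \<Rightarrow> (real^'n) set" where
  "Hplane d = {x. vsum x = (ntot d - 1) / 2}"

text \<open>u = sum_{c in C} F_c e^{c.q} is a superpotential for S = sum_{w in W} A_w e^{w.q}.\<close>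
definition superpotential ::
  "real^'n \<Rightarrow> (real^'n) set \<Rightarrow> (real^'n \<Rightarrow> real) \<Rightarrow> (real^'n) set \<Rightarrow> (real^'n \<Rightarrow> real) \<Rightarrow> bool" where
  "superpotential d W A C F \<longleftrightarrow>
     finite C \<and> (\<forall>c\<in>C. F c \<noteq> 0) \<and>
     (\<forall>\<xi>. (\<Sum>(a,c)\<in>{(a,c). a \<in> C \<and> c \<in> C \<and> a + c = \<xi>}. Jform d a c * F a * F c)
            = (if \<exists>w\<in>W. \<xi> = d + w then A (\<xi> - d) else 0))"

definition central_proj :: "real^'n \<Rightarrow> (real^'n) set \<Rightarrow> real^'n \<Rightarrow> real^'n" where
  "central_proj c H' z = (THE y. y \<in> H' \<and> (\<exists>t\<ge>0. y = c + t *\<^sub>R (z - c)))"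

end

theory Submission
  imports Defs
begin

text \<open>Cut the cone spanned by \<open>C - c\<close> at its apex \<open>c\<close> by a hyperplane. Along each extreme ray, the
  sum of \<open>c\<close> and the nearest point of \<open>C\<close>, and twice the farthest point \<open>e\<close> of \<open>C\<close>, arise in only
  one way as a sum of two elements of \<open>C\<close>. The superpotential equation therefore puts the first
  midpoint on the ray into \<open>V = (d + W)/2\<close> unless \<open>c\<close> is \<open>J\<close>-orthogonal to the ray, and makes \<open>e\<close>
  null unless \<open>e\<close> lies in \<open>V\<close>. Two distinct null points of \<open>Hplane d\<close> are never orthogonal, so every
  extreme ray meets \<open>V\<close>. As \<open>V\<close> lies in the convex hull of \<open>C\<close>, both sets span the same cone at \<open>c\<close>,
  and a vertex of \<open>\<Delta>\<close> gives an extreme ray of it. If this ray meets \<open>conv V\<close> in one point only and is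
  not orthogonal to \<open>c\<close>, then the same uniqueness argument for the two farthest points shows that
  \<open>e\<close> is the only point of \<open>C\<close> on the ray besides \<open>c\<close>, and \<open>(c + e)/2\<close> is the point in \<open>V\<close>.\<close>

section \<open>Radial projection onto a hyperplane slice\<close>

text \<open>A ray from the origin on which \<open>f\<close> is positive is represented by its point
  on the slice where \<open>f\<close> equals 1, so cross-sections of a cone by different hyperplanes
  become comparable.\<close>

definition persp :: "'a::real_inner \<Rightarrow> 'a \<Rightarrow> 'a" where
  "persp f x = (1 / (f \<bullet> x)) *\<^sub>R x"

lemma inner_persp [simp]: "f \<bullet> x \<noteq> 0 \<Longrightarrow> f \<bullet> persp f x = 1"
  by (simp add: persp_def)

lemma scaleR_inner_persp: "f \<bullet> x \<noteq> 0 \<Longrightarrow> (f \<bullet> x) *\<^sub>R persp f x = x"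
  by (simp add: persp_def)

lemma persp_scaleR: "s \<noteq> 0 \<Longrightarrow> persp f (s *\<^sub>R x) = persp f x"
  by (simp add: persp_def)

lemma persp_add:
  assumes "f \<bullet> x > 0" "f \<bullet> y > 0"
  shows "persp f (x + y) = (f \<bullet> x / (f \<bullet> x + f \<bullet> y)) *\<^sub>R persp f x
      + (f \<bullet> y / (f \<bullet> x + f \<bullet> y)) *\<^sub>R persp f y"
  using assms by (simp add: persp_def inner_add_right scaleR_add_right)

lemma convex_persp_image:
  assumes S: "convex S" and pos: "\<And>x. x \<in> S \<Longrightarrow> f \<bullet> x > 0"
  shows "convex (persp f ` S)"
proof (rule convexI)
  fix a b and u v :: real
  assume "a \<in> persp f ` S" "b \<in> persp f ` S" and uv: "0 \<le> u" "0 \<le> v" "u + v = 1"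
  then obtain x y where xy: "x \<in> S" "y \<in> S" "a = persp f x" "b = persp f y" by blast
  \<comment> \<open>Dividing by the heights gives \<open>\<alpha> *\<^sub>R x + \<beta> *\<^sub>R y
    = u *\<^sub>R a + v *\<^sub>R b\<close>. Normalising these weights yields a point
    \<open>z\<close> of \<open>S\<close> on the same ray.\<close>
  define \<alpha> \<beta> where "\<alpha> = u / (f \<bullet> x)" and "\<beta> = v / (f \<bullet> y)"
  have fx: "f \<bullet> x > 0" "f \<bullet> y > 0" using xy pos by auto
  have nn: "\<alpha> \<ge> 0" "\<beta> \<ge> 0" using fx uv by (auto simp: \<alpha>_def \<beta>_def)
  have "\<alpha> > 0 \<or> \<beta> > 0" using fx uv by (cases "u > 0") (auto simp: \<alpha>_def \<beta>_def)
  then have s: "\<alpha> + \<beta> > 0" using nn by linarith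
  define z where "z = (\<alpha> / (\<alpha> + \<beta>)) *\<^sub>R x + (\<beta> / (\<alpha> + \<beta>)) *\<^sub>R y"
  have "z \<in> S" unfolding z_def
    using S xy nn s by (intro convexD) (auto simp: add_divide_distrib[symmetric])
  moreover have eq: "\<alpha> *\<^sub>R x + \<beta> *\<^sub>R y = (\<alpha> + \<beta>) *\<^sub>R z"
    using s by (simp add: z_def scaleR_add_right)
  have "f \<bullet> (\<alpha> *\<^sub>R x + \<beta> *\<^sub>R y) = 1"
    using fx uv by (simp add: \<alpha>_def \<beta>_def inner_add_right)
  then have "persp f z = \<alpha> *\<^sub>R x + \<beta> *\<^sub>R y"
    using persp_scaleR[of "\<alpha> + \<beta>" f z] s unfolding eq[symmetric] by (simp add: persp_def)
  then have "persp f z = u *\<^sub>R a + v *\<^sub>R b"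
    by (simp add: xy persp_def \<alpha>_def \<beta>_def)
  ultimately show "u *\<^sub>R a + v *\<^sub>R b \<in> persp f ` S" by (metis image_eqI)
qed

section \<open>The form J and the superpotential equation\<close>

lemma vsum_simps [simp]:
  "vsum (x + y) = vsum x + vsum y" "vsum (x - y) = vsum x - vsum y" "vsum (s *\<^sub>R x) = s * vsum x"
  by (simp_all add: vsum_def sum.distrib sum_subtractf sum_distrib_left)

lemma Jform_sym: "Jform d p q = Jform d q p"
  by (simp add: Jform_def mult.commute)

lemma bilinear_Jform: "bilinear (Jform d)"
  unfolding bilinear_def
  by (auto intro!: linearI simp: Jform_def sum.distrib sum_distrib_left add_divide_distrib
      algebra_simps)

lemmas Jform_simps = bilinear_ladd[OF bilinear_Jform] bilinear_radd[OF bilinear_Jform]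
  bilinear_lsub[OF bilinear_Jform] bilinear_rsub[OF bilinear_Jform]
  bilinear_lmul[OF bilinear_Jform] bilinear_rmul[OF bilinear_Jform]

text \<open>\<open>J\<close> is negative definite on the direction space of \<open>Hplane d\<close>, and
  \<open>J(x - y, x - y) = - 2 J(x, y)\<close> for null \<open>x\<close> and \<open>y\<close>.\<close>

lemma null_orthogonal_imp_eq:
  fixes d :: "real^'n"
  assumes d: "\<And>i. d $ i > 0" and "x \<in> Hplane d" "y \<in> Hplane d"
    and "is_null d x" "is_null d y" "Jform d x y = 0"
  shows "x = y"
proof -
  have "Jform d (x - y) (x - y) = 0"
    using assms Jform_sym[of d x y] by (simp add: Jform_simps is_null_def)
  moreover have "vsum (x - y) = 0" using assms by (simp add: Hplane_def)
  ultimately have "(\<Sum>i\<in>UNIV. (x - y) $ i * (x - y) $ i / d $ i) = 0"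
    by (simp add: Jform_def)
  moreover have "\<And>i. (x - y) $ i * (x - y) $ i / d $ i \<ge> 0"
    using d by (simp add: less_imp_le)
  ultimately have "\<forall>i\<in>UNIV. (x - y) $ i * (x - y) $ i / d $ i = 0"
    by (subst (asm) sum_nonneg_eq_0_iff) auto
  moreover have "\<And>i. d $ i \<noteq> 0" using d by (simp add: less_imp_neq[symmetric])
  ultimately show ?thesis by (simp add: vec_eq_iff)
qed

text \<open>The equation at \<open>a + b\<close> has right-hand side 0, and its left-hand side is
  \<open>Jform d a b\<close> times \<open>2 * F a * F b\<close>, or times \<open>(F a)^2\<close> if
  \<open>a = b\<close>; the coefficients \<open>F\<close> do not vanish.\<close>

lemma superpotential_unique_pair:
  assumes sup: "superpotential d W A C F" and "a \<in> C" "b \<in> C"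
    and uniq: "\<And>p q. p \<in> C \<Longrightarrow> q \<in> C \<Longrightarrow> p + q = a + b \<Longrightarrow> p = a \<and> q = b \<or> p = b \<and> q = a"
    and W: "(1/2) *\<^sub>R (a + b) \<notin> (\<lambda>w. (1/2) *\<^sub>R (d + w)) ` W"
  shows "Jform d a b = 0"
proof -
  have F: "F a \<noteq> 0" "F b \<noteq> 0" using sup assms(2,3) by (auto simp: superpotential_def)
  have "\<not> (\<exists>w\<in>W. a + b = d + w)" using W by auto
  then have "(\<Sum>(p,q)\<in>{(p,q). p \<in> C \<and> q \<in> C \<and> p + q = a + b}. Jform d p q * F p * F q) = 0"
    using sup unfolding superpotential_def by auto
  moreover have "{(p,q). p \<in> C \<and> q \<in> C \<and> p + q = a + b} = {(a,b),(b,a)}"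
    using assms(2,3) uniq by (auto simp: add.commute)
  ultimately have "(\<Sum>(p,q)\<in>{(a,b),(b,a)}. Jform d p q * F p * F q) = 0" by simp
  then show ?thesis using F Jform_sym[of d a b]
    by (cases "a = b") auto
qed

text \<open>The equation at \<open>d + w\<close> has a nonzero right-hand side, so its sum is not
  empty.\<close>

lemma superpotential_midpoint:
  assumes sup: "superpotential d W A C F" and "w \<in> W" "A w \<noteq> 0"
  obtains a b where "a \<in> C" "b \<in> C" "(1/2) *\<^sub>R (d + w) = (1/2) *\<^sub>R (a + b)"
proof -
  have "(\<Sum>(p,q)\<in>{(p,q). p \<in> C \<and> q \<in> C \<and> p + q = d + w}. Jform d p q * F p * F q) = A w"
    using sup assms(2) unfolding superpotential_def by auto
  with assms(3) have "{(p,q). p \<in> C \<and> q \<in> C \<and> p + q = d + w} \<noteq> {}"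
    by (intro notI) simp
  then show ?thesis using that by force
qed

section \<open>The cone spanned by C at the null vertex\<close>

text \<open>The functional \<open>\<psi>\<close> exposes \<open>c\<close> as a vertex. The convex
  hull of \<open>Y\<close> is the cross-section at \<open>\<psi>\<close>-height 1 of the cone
  spanned by \<open>C - c\<close>, and \<open>V\<close> is the weight set moved into the scale of
  \<open>C\<close>.\<close>

locale null_vertex =
  fixes d :: "real^'n" and W C :: "(real^'n) set" and A F :: "real^'n \<Rightarrow> real"
    and c \<psi> :: "real^'n" and V Y :: "(real^'n) set"
  defines "V \<equiv> (\<lambda>w. (1/2) *\<^sub>R (d + w)) ` W"
    and "Y \<equiv> (\<lambda>p. persp \<psi> (p - c)) ` (C - {c})"
  assumes d_pos: "\<And>i. d $ i > 0"
    and A_nonzero: "\<And>w. w \<in> W \<Longrightarrow> A w \<noteq> 0"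
    and sup: "superpotential d W A C F"
    and C_subset: "C \<subseteq> Hplane d"
    and c_in: "c \<in> C"
    and c_null: "is_null d c"
    and \<psi>_pos: "\<And>p. p \<in> C \<Longrightarrow> p \<noteq> c \<Longrightarrow> \<psi> \<bullet> (p - c) > 0"
    and c_notin: "c \<notin> convex hull V"
begin

lemma finite_C: "finite C"
  using sup by (simp add: superpotential_def)

lemma finite_Y: "finite Y"
  by (simp add: Y_def finite_C)

lemma \<psi>_nonneg: "p \<in> C \<Longrightarrow> \<psi> \<bullet> (p - c) \<ge> 0"
  using \<psi>_pos[of p] by (cases "p = c") auto

lemma unique_pair:
  assumes "a \<in> C" "b \<in> C" "(1/2) *\<^sub>R (a + b) \<notin> V"
    and "\<And>p q. p \<in> C \<Longrightarrow> q \<in> C \<Longrightarrow> p + q = a + b \<Longrightarrow> p = a \<and> q = b \<or> p = b \<and> q = a"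
  shows "Jform d a b = 0"
  using superpotential_unique_pair[OF sup assms(1,2)] assms(3,4) unfolding V_def by blast

lemma null_eqI:
  assumes "a \<in> C" "b \<in> C" "is_null d a" "is_null d b" "Jform d a b = 0"
  shows "a = b"
  using null_orthogonal_imp_eq[OF d_pos] assms C_subset by blast

lemma hull_V_subset: "convex hull V \<subseteq> convex hull C"
proof (rule hull_minimal)
  show "V \<subseteq> convex hull C"
  proof
    fix v assume "v \<in> V"
    then obtain w where w: "w \<in> W" "v = (1/2) *\<^sub>R (d + w)" by (auto simp: V_def)
    obtain a b where "a \<in> C" "b \<in> C" "v = (1/2) *\<^sub>R (a + b)"
      using superpotential_midpoint[OF sup w(1) A_nonzero[OF w(1)]] w(2) by metis
    then show "v \<in> convex hull C"
      using convexD[OF convex_convex_hull, of a C b "1/2" "1/2"]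
      by (simp add: hull_inc scaleR_add_right)
  qed
qed auto

lemma hull_dir:
  assumes z: "z \<in> convex hull C" and ne: "z \<noteq> c"
  shows "\<psi> \<bullet> (z - c) > 0" "persp \<psi> (z - c) \<in> convex hull Y"
proof -
  obtain u where u: "\<forall>x\<in>C. 0 \<le> u x" "sum u C = 1" "(\<Sum>x\<in>C. u x *\<^sub>R x) = z"
    using z finite_C by (auto simp: convex_hull_finite)
  \<comment> \<open>\<open>s\<close> is the \<open>\<psi>\<close>-height of \<open>z - c\<close>.
    Divided by \<open>s\<close>, the summands become the weights of
    \<open>persp \<psi> (z - c)\<close> as a convex combination of points of
    \<open>Y\<close>.\<close>
  define s where "s = (\<Sum>p\<in>C - {c}. u p * (\<psi> \<bullet> (p - c)))"
  have "z - c = (\<Sum>x\<in>C. u x *\<^sub>R (x - c))"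
    using u(2,3) by (simp add: scaleR_diff_right sum_subtractf flip: scaleR_left.sum)
  also have "\<dots> = (\<Sum>x\<in>C - {c}. u x *\<^sub>R (x - c))"
    using finite_C by (intro sum.mono_neutral_right) auto
  finally have zc: "z - c = (\<Sum>x\<in>C - {c}. u x *\<^sub>R (x - c))" .
  have s: "\<psi> \<bullet> (z - c) = s"
    by (simp add: zc s_def inner_sum_right)
  have nn: "\<And>p. p \<in> C - {c} \<Longrightarrow> u p * (\<psi> \<bullet> (p - c)) \<ge> 0"
    using u \<psi>_nonneg by simp
  have "s \<noteq> 0"
  proof
    assume "s = 0"
    then have "\<forall>p\<in>C - {c}. u p * (\<psi> \<bullet> (p - c)) = 0"
      unfolding s_def using nn finite_C by (subst (asm) sum_nonneg_eq_0_iff) auto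
    then have "\<forall>p\<in>C - {c}. u p = 0" using \<psi>_pos by fastforce
    then have "z - c = 0" unfolding zc by simp
    with ne show False by simp
  qed
  moreover have "s \<ge> 0" unfolding s_def using nn by (rule sum_nonneg)
  ultimately have sp: "s > 0" by simp
  then show "\<psi> \<bullet> (z - c) > 0" using s by simp
  have "(\<Sum>p\<in>C - {c}. (u p * (\<psi> \<bullet> (p - c)) / s) *\<^sub>R persp \<psi> (p - c)) \<in> convex hull Y"
  proof (rule convex_sum)
    show "(\<Sum>p\<in>C - {c}. u p * (\<psi> \<bullet> (p - c)) / s) = 1"
      using sp by (simp add: s_def flip: sum_divide_distrib)
    show "\<And>p. p \<in> C - {c} \<Longrightarrow> 0 \<le> u p * (\<psi> \<bullet> (p - c)) / s"
      using nn sp by simp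
    show "\<And>p. p \<in> C - {c} \<Longrightarrow> persp \<psi> (p - c) \<in> convex hull Y"
      by (auto simp: Y_def intro!: hull_inc)
  qed (use finite_C in auto)
  also have "(\<Sum>p\<in>C - {c}. (u p * (\<psi> \<bullet> (p - c)) / s) *\<^sub>R persp \<psi> (p - c)) = (1 / s) *\<^sub>R (z - c)"
    unfolding zc scaleR_sum_right
  proof (rule sum.cong[OF refl])
    fix p assume "p \<in> C - {c}"
    then have "\<psi> \<bullet> (p - c) > 0" using \<psi>_pos by auto
    then show "(u p * (\<psi> \<bullet> (p - c)) / s) *\<^sub>R persp \<psi> (p - c) = (1 / s) *\<^sub>R u p *\<^sub>R (p - c)"
      by (simp add: persp_def)
  qed
  finally show "persp \<psi> (z - c) \<in> convex hull Y" by (simp add: persp_def s)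
qed

end

section \<open>The points of C on one extreme ray\<close>

locale null_vertex_ray = null_vertex +
  fixes y
  assumes y_extreme: "y extreme_point_of convex hull Y"
begin

text \<open>Parameters along the ray are \<open>\<psi>\<close>-heights, since
  \<open>\<psi> \<bullet> y = 1\<close>. The apex, at parameter 0, is left out so that
  \<open>Min R\<close> marks the nearest point of \<open>C\<close> beyond it.\<close>

definition R where "R = {s. s > 0 \<and> c + s *\<^sub>R y \<in> C}"

lemma \<psi>_y: "\<psi> \<bullet> y = 1" and y_ne: "y \<noteq> 0" and R_ne: "R \<noteq> {}"
proof -
  obtain p where p: "p \<in> C" "p \<noteq> c" "y = persp \<psi> (p - c)"
    using extreme_point_of_convex_hull[OF y_extreme] by (auto simp: Y_def)
  then show "\<psi> \<bullet> y = 1" using \<psi>_pos[of p] by simp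
  then show "y \<noteq> 0" by auto
  have "c + (\<psi> \<bullet> (p - c)) *\<^sub>R y = p" using p \<psi>_pos[of p] by (simp add: scaleR_inner_persp)
  then have "\<psi> \<bullet> (p - c) \<in> R" using p(1,2) \<psi>_pos[of p] unfolding R_def by simp
  then show "R \<noteq> {}" by blast
qed

lemma finite_R: "finite R"
proof (rule finite_surj[OF finite_C])
  show "R \<subseteq> (\<lambda>p. \<psi> \<bullet> (p - c)) ` C"
  proof
    fix s assume "s \<in> R"
    then show "s \<in> (\<lambda>p. \<psi> \<bullet> (p - c)) ` C"
      by (intro image_eqI[of _ _ "c + s *\<^sub>R y"]) (auto simp: R_def \<psi>_y)
  qed
qed

text \<open>Two vectors of a cone whose sum lies on an extreme ray lie on that ray themselves.
  Decompositions in \<open>C\<close> thus reduce to sums of parameters in \<open>R\<close> with 0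
  added.\<close>

lemma ray_pair:
  assumes p: "p \<in> C" and q: "q \<in> C" and pq: "p + q = (c + a *\<^sub>R y) + (c + b *\<^sub>R y)"
  obtains s t where "p = c + s *\<^sub>R y" "q = c + t *\<^sub>R y" "s + t = a + b"
    "s = 0 \<or> s \<in> R" "t = 0 \<or> t \<in> R"
proof -
  define s t where "s = \<psi> \<bullet> (p - c)" and "t = \<psi> \<bullet> (q - c)"
  have eq: "(p - c) + (q - c) = (a + b) *\<^sub>R y"
    using pq by (simp add: algebra_simps)
  have "s + t = \<psi> \<bullet> ((p - c) + (q - c))"
    by (simp only: s_def t_def inner_add_right)
  also have "\<dots> = a + b"
    by (simp only: eq inner_scaleR_right \<psi>_y mult_1_right)
  finally have st: "s + t = a + b" .
  have "p = c + s *\<^sub>R y \<and> q = c + t *\<^sub>R y"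
  proof (cases "p = c \<or> q = c")
    case True
    then show ?thesis using eq st by (auto simp: s_def t_def algebra_simps)
  next
    case False
    then have pos: "s > 0" "t > 0" using p q \<psi>_pos by (auto simp: s_def t_def)
    define yp yq where "yp = persp \<psi> (p - c)" and "yq = persp \<psi> (q - c)"
    have Y: "yp \<in> convex hull Y" "yq \<in> convex hull Y"
      using p q False by (auto simp: Y_def yp_def yq_def intro!: hull_inc)
    have pp: "p - c = s *\<^sub>R yp" "q - c = t *\<^sub>R yq"
      using pos by (auto simp: yp_def yq_def s_def t_def scaleR_inner_persp)
    \<comment> \<open>With both heights positive, \<open>y\<close> is a proper convex combination of
      \<open>yp\<close> and \<open>yq\<close>, so extremality forces these to coincide.\<close>
    have "y = (1 / (s + t)) *\<^sub>R (s *\<^sub>R yp + t *\<^sub>R yq)"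
      using eq st pos unfolding pp by simp
    then have y: "y = (s / (s + t)) *\<^sub>R yp + (t / (s + t)) *\<^sub>R yq"
      by (simp add: scaleR_add_right)
    have "1 - t / (s + t) = s / (s + t)" using pos by (simp add: field_simps)
    then have "y = (1 - t / (s + t)) *\<^sub>R yp + (t / (s + t)) *\<^sub>R yq" using y by simp
    moreover have "0 < t / (s + t)" "t / (s + t) < 1" using pos by auto
    ultimately have "y \<in> open_segment yp yq" if "yp \<noteq> yq"
      using that unfolding in_segment by blast
    with Y y_extreme have "yp = yq" by (auto simp: extreme_point_of_def)
    moreover from this have "y = yp"
      using y pos by (simp add: flip: scaleR_add_left add_divide_distrib)
    ultimately show ?thesis using pp by (simp add: algebra_simps)
  qed
  moreover have "s \<ge> 0" "t \<ge> 0" using p q \<psi>_nonneg by (auto simp: s_def t_def)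
  ultimately show ?thesis using that[of s t] st p q by (auto simp: R_def less_le)
qed

lemma Jform_ray: "Jform d c (c + s *\<^sub>R y) = s * Jform d c y"
  using c_null by (simp add: Jform_simps is_null_def)

lemma Min_R: "Min R \<in> R" "\<And>s. s \<in> R \<Longrightarrow> Min R \<le> s" "Min R > 0"
  using finite_R R_ne Min_in[of R] by (auto simp: R_def)

lemma Max_R: "Max R \<in> R" "\<And>s. s \<in> R \<Longrightarrow> s \<le> Max R" "Max R > 0"
  using finite_R R_ne Max_in[of R] by (auto simp: R_def)

lemma le_Max_R: "s = 0 \<or> s \<in> R \<Longrightarrow> s \<le> Max R"
  using Max_R(2)[of s] Max_R(3) by (elim disjE) simp_all

lemma R_point: "s \<in> R \<Longrightarrow> s > 0" "s \<in> R \<Longrightarrow> c + s *\<^sub>R y \<in> C"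
  by (auto simp: R_def)

text \<open>Two parameters with sum \<open>Min R\<close>, each 0 or at least \<open>Min R\<close>,
  must be 0 and \<open>Min R\<close>. Outside \<open>V\<close> this unique decomposition would make
  \<open>c\<close> orthogonal to the ray.\<close>

lemma first_midpoint_in_V:
  assumes "Jform d c y \<noteq> 0"
  shows "c + (Min R / 2) *\<^sub>R y \<in> V"
proof (rule ccontr)
  assume nV: "c + (Min R / 2) *\<^sub>R y \<notin> V"
  have "Jform d c (c + Min R *\<^sub>R y) = 0"
  proof (rule unique_pair[OF c_in R_point(2)[OF Min_R(1)]])
    have "(1/2) *\<^sub>R (c + (c + Min R *\<^sub>R y)) = c + (Min R / 2) *\<^sub>R y"
      by (simp add: scaleR_add_right flip: scaleR_add_left)
    then show "(1/2) *\<^sub>R (c + (c + Min R *\<^sub>R y)) \<notin> V" using nV by simp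
    fix p q assume pq: "p \<in> C" "q \<in> C" "p + q = c + (c + Min R *\<^sub>R y)"
    have "p + q = (c + 0 *\<^sub>R y) + (c + Min R *\<^sub>R y)" using pq(3) by simp
    then obtain s t where st: "p = c + s *\<^sub>R y" "q = c + t *\<^sub>R y" "s + t = 0 + Min R"
      "s = 0 \<or> s \<in> R" "t = 0 \<or> t \<in> R"
      by (rule ray_pair[OF pq(1,2)])
    then have "s = 0 \<and> t = Min R \<or> s = Min R \<and> t = 0"
      using Min_R(2)[of s] Min_R(2)[of t] Min_R(3) by auto
    then show "p = c \<and> q = c + Min R *\<^sub>R y \<or> p = c + Min R *\<^sub>R y \<and> q = c"
      using st by auto
  qed
  then show False using assms Min_R(3) by (simp add: Jform_ray)
qed

text \<open>Two parameters at most \<open>Max R\<close> with sum \<open>2 * Max R\<close> both equal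
  \<open>Max R\<close>, so the farthest point is paired only with itself.\<close>

lemma last_point_null:
  assumes "c + Max R *\<^sub>R y \<notin> V"
  shows "is_null d (c + Max R *\<^sub>R y)"
  unfolding is_null_def
proof (rule unique_pair)
  show "(1/2) *\<^sub>R (c + Max R *\<^sub>R y + (c + Max R *\<^sub>R y)) \<notin> V"
    using assms by (simp add: flip: scaleR_2)
  fix p q assume pq: "p \<in> C" "q \<in> C" "p + q = c + Max R *\<^sub>R y + (c + Max R *\<^sub>R y)"
  obtain s t where st: "p = c + s *\<^sub>R y" "q = c + t *\<^sub>R y" "s + t = Max R + Max R"
    "s = 0 \<or> s \<in> R" "t = 0 \<or> t \<in> R"
    by (rule ray_pair[OF pq])
  moreover have "s \<le> Max R" "t \<le> Max R" using st(4,5) le_Max_R by blast+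
  ultimately have "s = Max R" "t = Max R" by linarith+
  then show "p = c + Max R *\<^sub>R y \<and> q = c + Max R *\<^sub>R y \<or>
      p = c + Max R *\<^sub>R y \<and> q = c + Max R *\<^sub>R y" using st by auto
qed (use R_point Max_R in auto)

text \<open>If \<open>c\<close> is orthogonal to the ray and the farthest point is not in
  \<open>V\<close>, that point is null and orthogonal to the null vector \<open>c\<close>, hence
  equal to \<open>c\<close>, which is absurd. Otherwise the first midpoint or the farthest point is
  in \<open>V\<close>.\<close>

lemma ray_meets_V: "\<exists>s>0. c + s *\<^sub>R y \<in> V"
proof (cases "Jform d c y = 0 \<and> c + Max R *\<^sub>R y \<notin> V")
  case True
  then have "c = c + Max R *\<^sub>R y"
    using last_point_null R_point(2)[OF Max_R(1)] c_in c_null by (intro null_eqI) (auto simp: Jform_ray)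
  then show ?thesis using y_ne Max_R(3) by simp
next
  case False
  then show ?thesis using first_midpoint_in_V Min_R(3) Max_R(3) half_gt_zero by blast
qed

text \<open>The only point of \<open>V\<close> on the line is the first midpoint. All other sums
  then have to vanish, which leaves a single point of \<open>C\<close> beyond \<open>c\<close>, and
  that point is null.\<close>

lemma null_reflection:
  assumes J: "Jform d c y \<noteq> 0" and uniq: "\<And>s t. c + s *\<^sub>R y \<in> V \<Longrightarrow> c + t *\<^sub>R y \<in> V \<Longrightarrow> s = t"
  obtains a s where "a \<in> C" "is_null d a" "s > 0" "c + s *\<^sub>R y \<in> V" "(1/2) *\<^sub>R (a + c) = c + s *\<^sub>R y"
proof -
  have V: "s = Min R / 2" if "c + s *\<^sub>R y \<in> V" for s
    using uniq[OF that first_midpoint_in_V[OF J]] .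
  have "Min R \<le> Max R" using Min_R Max_R by blast
  then have "Max R \<noteq> Min R / 2" using Min_R(3) by linarith
  then have e: "is_null d (c + Max R *\<^sub>R y)" using V last_point_null by blast
  have "R - {Max R} = {}"
  proof (rule ccontr)
    assume ne: "R - {Max R} \<noteq> {}"
    \<comment> \<open>\<open>m\<close> is the second largest parameter. A sum
      \<open>Max R + m\<close> must use \<open>Max R\<close>, since otherwise both parameters would
      be at most \<open>m\<close>.\<close>
    define m where "m = Max (R - {Max R})"
    have m: "m \<in> R" "m \<noteq> Max R" and m_max: "\<And>s. s \<in> R \<Longrightarrow> s \<noteq> Max R \<Longrightarrow> s \<le> m"
      using Max_in[OF _ ne] finite_R by (auto simp: m_def)
    have mM: "m < Max R" using m Max_R(2)[of m] by simp
    have "Jform d (c + Max R *\<^sub>R y) (c + m *\<^sub>R y) = 0"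
    proof (rule unique_pair)
      have eq: "(1/2) *\<^sub>R (c + Max R *\<^sub>R y + (c + m *\<^sub>R y)) = c + ((Max R + m) / 2) *\<^sub>R y"
        by (simp add: vec_eq_iff field_simps)
      \<comment> \<open>Because \<open>m\<close> is at least \<open>Min R\<close>, this midpoint
        lies strictly beyond the unique point of \<open>V\<close> on the line.\<close>
      have "(Max R + m) / 2 \<noteq> Min R / 2" using Min_R(2)[OF m(1)] Max_R(3) by simp
      then show "(1/2) *\<^sub>R (c + Max R *\<^sub>R y + (c + m *\<^sub>R y)) \<notin> V"
        unfolding eq using V by blast
      fix p q assume pq: "p \<in> C" "q \<in> C" "p + q = c + Max R *\<^sub>R y + (c + m *\<^sub>R y)"
      obtain s t where st: "p = c + s *\<^sub>R y" "q = c + t *\<^sub>R y" "s + t = Max R + m"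
        "s = 0 \<or> s \<in> R" "t = 0 \<or> t \<in> R"
        by (rule ray_pair[OF pq])
      then have "s = Max R \<and> t = m \<or> s = m \<and> t = Max R"
        using m_max[of s] m_max[of t] R_point(1)[OF m(1)] mM by fastforce
      then show "p = c + Max R *\<^sub>R y \<and> q = c + m *\<^sub>R y \<or> p = c + m *\<^sub>R y \<and> q = c + Max R *\<^sub>R y"
        using st by auto
    qed (use m R_point Max_R in auto)
    \<comment> \<open>With one argument fixed at the farthest point, \<open>J\<close> is affine
      along the line. It vanishes at parameters \<open>Max R\<close> and \<open>m\<close>, hence
      also at \<open>c\<close>, against the assumption on \<open>Jform d c y\<close>.\<close>
    moreover have "Jform d (c + Max R *\<^sub>R y) (c + m *\<^sub>R y)
        = Jform d (c + Max R *\<^sub>R y) (c + Max R *\<^sub>R y) - (Max R - m) * Jform d (c + Max R *\<^sub>R y) y"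
      by (simp add: Jform_simps algebra_simps)
    ultimately have "Jform d (c + Max R *\<^sub>R y) y = 0"
      using e mM by (simp add: is_null_def)
    moreover have "Jform d (c + Max R *\<^sub>R y) c
        = Jform d (c + Max R *\<^sub>R y) (c + Max R *\<^sub>R y) - Max R * Jform d (c + Max R *\<^sub>R y) y"
      by (simp add: Jform_simps algebra_simps)
    ultimately have "Jform d c (c + Max R *\<^sub>R y) = 0"
      using e Jform_sym[of d c "c + Max R *\<^sub>R y"] by (simp add: is_null_def)
    then show False using J Max_R(3) by (simp add: Jform_ray)
  qed
  then have "Max R = Min R" using Min_R(1) by (metis Diff_iff empty_iff singletonD singletonI)
  show thesis
  proof (rule that[of "c + Max R *\<^sub>R y" "Min R / 2"])
    show "(1/2) *\<^sub>R (c + Max R *\<^sub>R y + c) = c + (Min R / 2) *\<^sub>R y"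
      using \<open>Max R = Min R\<close> by (simp add: vec_eq_iff field_simps)
  qed (use e R_point Max_R Min_R first_midpoint_in_V[OF J] in auto)
qed

end

section \<open>Extreme rays and central projection\<close>

text \<open>By \<open>persp_add\<close>, the projection of a positive combination is a convex
  combination of the projections with both weights positive; extremality of \<open>\<eta>\<close>
  collapses it.\<close>

lemma extreme_persp_ray:
  assumes \<eta>: "\<eta> extreme_point_of persp h ` D" and pos: "\<And>x. x \<in> D \<Longrightarrow> h \<bullet> x > 0"
    and D: "x1 \<in> D" "x2 \<in> D" and x: "persp h x = \<eta>"
    and ab: "s > 0" "\<alpha> > 0" "\<beta> > 0" and eq: "s *\<^sub>R x = \<alpha> *\<^sub>R x1 + \<beta> *\<^sub>R x2"
  shows "persp h x1 = \<eta> \<and> persp h x2 = \<eta>"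
proof -
  have p: "h \<bullet> (\<alpha> *\<^sub>R x1) > 0" "h \<bullet> (\<beta> *\<^sub>R x2) > 0" using pos D ab by auto
  define v where "v = h \<bullet> (\<beta> *\<^sub>R x2) / (h \<bullet> (\<alpha> *\<^sub>R x1) + h \<bullet> (\<beta> *\<^sub>R x2))"
  have v: "0 < v" "v < 1" using p by (auto simp: v_def)
  have v': "h \<bullet> (\<alpha> *\<^sub>R x1) / (h \<bullet> (\<alpha> *\<^sub>R x1) + h \<bullet> (\<beta> *\<^sub>R x2)) = 1 - v"
    using p by (simp only: v_def) (simp only: field_simps, simp)
  have "\<eta> = persp h (s *\<^sub>R x)" using ab x by (simp add: persp_scaleR)
  also have "\<dots> = (1 - v) *\<^sub>R persp h x1 + v *\<^sub>R persp h x2"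
    unfolding eq persp_add[OF p] v' using ab by (simp add: persp_scaleR v_def)
  finally have \<eta>_eq: "\<eta> = (1 - v) *\<^sub>R persp h x1 + v *\<^sub>R persp h x2" .
  have "persp h x1 = persp h x2"
  proof (rule ccontr)
    assume "persp h x1 \<noteq> persp h x2"
    then have "\<eta> \<in> open_segment (persp h x1) (persp h x2)"
      using v \<eta>_eq unfolding in_segment by blast
    then show False using \<eta> D by (auto simp: extreme_point_of_def)
  qed
  then show ?thesis using \<eta>_eq by (simp flip: scaleR_add_left)
qed

text \<open>Extreme points are singleton faces, and faces transport along injective linear maps and
  translations.\<close>

lemma extreme_point_of_affine_image:
  fixes S :: "'a::euclidean_space set"
  assumes "k \<noteq> 0" "c + k *\<^sub>R x extreme_point_of (\<lambda>x. c + k *\<^sub>R x) ` S"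
  shows "x extreme_point_of S"
proof -
  have "inj ((*\<^sub>R) k :: 'a \<Rightarrow> 'a)" "linear ((*\<^sub>R) k :: 'a \<Rightarrow> 'a)" 
    using assms(1) by (auto simp: inj_on_def linear_iff scaleR_add_right)
  moreover have "(+) c ` (*\<^sub>R) k ` {x} face_of (+) c ` (*\<^sub>R) k ` S"
    using assms(2) by (simp add: face_of_singleton image_image)
  ultimately show ?thesis
    by (simp only: face_of_translation_eq face_of_linear_image face_of_singleton)
qed

lemma affine_hull_pair: "affine hull {a, b} = range (\<lambda>t. a + t *\<^sub>R (b - a))"
proof -
  have "u *\<^sub>R a + v *\<^sub>R b = a + v *\<^sub>R (b - a)" if "u + v = 1" for u v
    using that by (simp add: eq_diff_eq[symmetric] scaleR_left_diff_distrib scaleR_diff_right)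
  then show ?thesis unfolding affine_hull_2
    by (auto simp: image_iff) (metis diff_add_cancel)
qed

text \<open>The value of \<open>h\<close> on the ray is affine in the parameter, so
  \<open>H'\<close> determines the parameter. This turns the central projection into
  \<open>persp h\<close> followed by a dilation and a translation.\<close>

lemma central_proj_eq:
  assumes "H' = {y \<in> Hplane d. h \<bullet> y = b}" and "c \<in> Hplane d" "z \<in> Hplane d"
    and "h \<bullet> c < b" "b < h \<bullet> z"
  shows "central_proj c H' z = c + (b - h \<bullet> c) *\<^sub>R persp h (z - c)"
  unfolding central_proj_def
proof (rule the_equality)
  have hz: "h \<bullet> (z - c) > 0" using assms by (simp add: inner_diff_right)
  have "c + (b - h \<bullet> c) *\<^sub>R persp h (z - c) \<in> H'"
    using assms hz by (simp add: Hplane_def inner_add_right) (simp add: persp_def)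
  then show "c + (b - h \<bullet> c) *\<^sub>R persp h (z - c) \<in> H' \<and>
      (\<exists>t\<ge>0. c + (b - h \<bullet> c) *\<^sub>R persp h (z - c) = c + t *\<^sub>R (z - c))"
    using hz assms by (auto simp: persp_def intro!: exI[of _ "(b - h \<bullet> c) / (h \<bullet> (z - c))"])
  fix y assume "y \<in> H' \<and> (\<exists>t\<ge>0. y = c + t *\<^sub>R (z - c))"
  then obtain t where t: "y = c + t *\<^sub>R (z - c)" "h \<bullet> y = b" using assms(1) by auto
  have "h \<bullet> c + t * (h \<bullet> (z - c)) = b"
    using t(2) unfolding t(1) by (simp only: inner_add_right inner_scaleR_right)
  then have "t = (b - h \<bullet> c) / (h \<bullet> (z - c))"
    using hz by (simp add: eq_divide_eq)
  then show "y = c + (b - h \<bullet> c) *\<^sub>R persp h (z - c)" by (simp add: t persp_def)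
qed

section \<open>Equality of the cones over C and over conv V\<close>

context null_vertex
begin

text \<open>Since \<open>persp\<close> projects from the origin, the apex \<open>c\<close> is
  translated there.\<close>

definition D where "D = (\<lambda>z. z - c) ` (convex hull V)"

lemma \<psi>_pos_D: "x \<in> D \<Longrightarrow> \<psi> \<bullet> x > 0"
  using hull_dir(1) hull_V_subset c_notin by (auto simp: D_def)

lemma convex_D: "convex D"
  unfolding D_def by (intro convex_translation_subtract) auto

text \<open>One inclusion comes from \<open>hull_V_subset\<close>. For the other, every extreme ray
  meets \<open>V\<close> by \<open>ray_meets_V\<close>, and the extreme points generate the polytope
  spanned by \<open>Y\<close>.\<close>

lemma hull_Y: "convex hull Y = persp \<psi> ` D"
proof
  show "persp \<psi> ` D \<subseteq> convex hull Y"
    using hull_dir(2) hull_V_subset c_notin by (auto simp: D_def)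
  have "{y. y extreme_point_of convex hull Y} \<subseteq> persp \<psi> ` D"
  proof
    fix y assume "y \<in> {y. y extreme_point_of convex hull Y}"
    then interpret null_vertex_ray d W C A F c \<psi> V Y y
      by unfold_locales (auto simp: V_def Y_def)
    obtain s where s: "s > 0" "c + s *\<^sub>R y \<in> V" using ray_meets_V by auto
    then have "s *\<^sub>R y \<in> D"
      unfolding D_def by (intro image_eqI[of _ _ "c + s *\<^sub>R y"]) (auto intro: hull_inc)
    moreover have "persp \<psi> (s *\<^sub>R y) = y" using s \<psi>_y by (simp add: persp_def)
    ultimately show "y \<in> persp \<psi> ` D" by (metis image_eqI)
  qed
  then have "convex hull {y. y extreme_point_of convex hull Y} \<subseteq> persp \<psi> ` D"
    by (intro hull_minimal convex_persp_image convex_D \<psi>_pos_D)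
  then show "convex hull Y \<subseteq> persp \<psi> ` D"
    using Krein_Milman_polytope[OF finite_Y] by simp
qed

text \<open>Extremality of a ray does not depend on the hyperplane used to cut the cone over \<open>D\<close>.\<close>

lemma extreme_point_hull_Y:
  assumes pos: "\<And>x. x \<in> D \<Longrightarrow> h \<bullet> x > 0"
    and ext: "persp h x extreme_point_of persp h ` D" and x: "x \<in> D"
  shows "persp \<psi> x extreme_point_of convex hull Y"
  unfolding extreme_point_of_def hull_Y
proof (intro conjI ballI notI)
  show "persp \<psi> x \<in> persp \<psi> ` D" using x by simp
  fix y1 y2 assume "y1 \<in> persp \<psi> ` D" "y2 \<in> persp \<psi> ` D" and seg: "persp \<psi> x \<in> open_segment y1 y2"
  then obtain x1 x2 where x12: "x1 \<in> D" "x2 \<in> D" "y1 = persp \<psi> x1" "y2 = persp \<psi> x2" by blast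
  obtain u where u: "0 < u" "u < 1" "persp \<psi> x = (1 - u) *\<^sub>R y1 + u *\<^sub>R y2" and ne: "y1 \<noteq> y2"
    using seg by (auto simp: in_segment)
  \<comment> \<open>Undoing the normalisation turns the convex combination on the
    \<open>\<psi>\<close>-slice into a positive combination in \<open>D\<close>, to which
    extremality on the \<open>h\<close>-slice applies.\<close>
  have "(1 / (\<psi> \<bullet> x)) *\<^sub>R x = ((1 - u) / (\<psi> \<bullet> x1)) *\<^sub>R x1 + (u / (\<psi> \<bullet> x2)) *\<^sub>R x2"
    using u(3) unfolding x12 by (simp add: persp_def)
  then have "persp h x1 = persp h x \<and> persp h x2 = persp h x"
    using u x x12 \<psi>_pos_D by (intro extreme_persp_ray[OF ext pos _ _ refl]) auto
  then have eq: "persp h x1 = persp h x2" by simp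
  have "persp \<psi> (persp h x1) = y1" "persp \<psi> (persp h x2) = y2"
    using pos[OF x12(1)] pos[OF x12(2)] x12 by (auto simp: persp_def[of h] persp_scaleR)
  with eq ne show False by simp
qed

end

section \<open>Weights, supporting functionals and rescaling\<close>

text \<open>This places the points \<open>(1/2) *\<^sub>R (d + w)\<close> in
  \<open>Hplane d\<close>.\<close>

lemma vsum_scal_weight:
  assumes "typeI w \<or> typeII w \<or> typeIII w"
  shows "vsum w = -1"
proof -
  have *: "vsum w = (\<Sum>l\<in>S. w $ l)" if "\<forall>l. l \<notin> S \<longrightarrow> w $ l = 0" for S
    unfolding vsum_def using that by (intro sum.mono_neutral_right) auto
  from assms show ?thesis
  proof (elim disjE)
    assume "typeI w"
    then obtain i where "w $ i = -1" "\<forall>l. l \<notin> {i} \<longrightarrow> w $ l = 0" by (auto simp: typeI_def)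
    with *[of "{i}"] show ?thesis by simp
  next
    assume "typeII w"
    then obtain i j k where "i \<noteq> j" "i \<noteq> k" "j \<noteq> k" "w $ i = 1" "w $ j = -1" "w $ k = -1"
      "\<forall>l. l \<notin> {i,j,k} \<longrightarrow> w $ l = 0" unfolding typeII_def by blast
    with *[of "{i,j,k}"] show ?thesis by simp
  next
    assume "typeIII w"
    then obtain i j where "i \<noteq> j" "w $ i = 1" "w $ j = -2" "\<forall>l. l \<notin> {i,j} \<longrightarrow> w $ l = 0"
      unfolding typeIII_def by blast
    with *[of "{i,j}"] show ?thesis by simp
  qed
qed

text \<open>Faces of a polytope are exposed, so some hyperplane touches the hull at \<open>c\<close>
  only; its normal with reversed sign serves as \<open>\<psi>\<close>.\<close>

lemma extreme_point_supporting:
  fixes C :: "'a::euclidean_space set"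
  assumes "finite C" "c extreme_point_of convex hull C"
  obtains \<psi> where "\<And>p. p \<in> C \<Longrightarrow> p \<noteq> c \<Longrightarrow> \<psi> \<bullet> (p - c) > 0"
proof -
  have "{c} exposed_face_of convex hull C"
    using assms by (simp add: exposed_face_of_polyhedron polytope_imp_polyhedron
        polytope_convex_hull face_of_singleton)
  then obtain a b where ab: "convex hull C \<subseteq> {x. a \<bullet> x \<le> b}" "{c} = convex hull C \<inter> {x. a \<bullet> x = b}"
    unfolding exposed_face_of_def by blast
  have "(- a) \<bullet> (p - c) > 0" if "p \<in> C" "p \<noteq> c" for p
  proof -
    have p: "p \<in> convex hull C" using that by (simp add: hull_inc)
    then have "a \<bullet> p \<le> b" "a \<bullet> p \<noteq> b" using ab that by auto
    moreover have "a \<bullet> c = b" using ab by auto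
    ultimately show ?thesis by (simp add: inner_diff_right)
  qed
  then show ?thesis by (rule that)
qed

text \<open>The similarity sending \<open>x\<close> to \<open>2 *\<^sub>R x - d\<close> undoes the
  passage from \<open>W\<close> to its rescaled copy, and it preserves faces.\<close>

lemma face_of_hull_rescale:
  fixes d :: "'a::euclidean_space"
  assumes "closed_segment v w face_of convex hull ((\<lambda>w. (1/2) *\<^sub>R (d + w)) ` W)"
  shows "closed_segment (2 *\<^sub>R v - d) (2 *\<^sub>R w - d) face_of convex hull W"
proof -
  let ?V = "(\<lambda>w. (1/2) *\<^sub>R (d + w)) ` W"
  have lin: "linear ((*\<^sub>R) 2 :: 'a \<Rightarrow> 'a)" "inj ((*\<^sub>R) 2 :: 'a \<Rightarrow> 'a)"
    by (auto simp: inj_on_def linear_iff scaleR_add_right)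
  have "(+) (- d) ` (*\<^sub>R) 2 ` ?V = W" by (simp add: image_image)
  then have "convex hull W = convex hull ((+) (- d) ` (*\<^sub>R) 2 ` ?V)" by simp
  then have "convex hull W = (+) (- d) ` (*\<^sub>R) 2 ` (convex hull ?V)"
    by (simp only: convex_hull_translation convex_hull_scaling)
  moreover have "closed_segment (2 *\<^sub>R v - d) (2 *\<^sub>R w - d)
      = (+) (- d) ` (*\<^sub>R) 2 ` closed_segment v w"
    using closed_segment_translation[of "- d" "2 *\<^sub>R v" "2 *\<^sub>R w"]
      closed_segment_linear_image[OF lin(1), of v w] by simp
  ultimately show ?thesis
    using assms by (simp only: face_of_translation_eq face_of_linear_image[OF lin])
qed

lemma collinear_rescale:
  fixes d :: "'a::real_vector"
  assumes "collinear S"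
  shows "collinear ((\<lambda>x. 2 *\<^sub>R x - d) ` S)"
proof -
  obtain u where u: "\<forall>x\<in>S. \<forall>y\<in>S. \<exists>c. x - y = c *\<^sub>R u" using assms by (auto simp: collinear_def)
  have "\<exists>c. 2 *\<^sub>R x - 2 *\<^sub>R y = c *\<^sub>R u" if xy: "x \<in> S" "y \<in> S" for x y
  proof -
    obtain c where "x - y = c *\<^sub>R u" using u xy by blast
    then have "2 *\<^sub>R x - 2 *\<^sub>R y = (2 * c) *\<^sub>R u" by (simp flip: scaleR_diff_right)
    then show ?thesis ..
  qed
  then show ?thesis unfolding collinear_def by auto
qed

section \<open>The trichotomy for a vertex of the projected polytope\<close>

theorem theorem3p8:
  fixes d :: "real^'n" and W C :: "(real^'n) set" and A F :: "real^'n \<Rightarrow> real"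
    and cb \<xi>b :: "real^'n" and H' :: "(real^'n) set"
  defines "K \<equiv> convex hull ((\<lambda>w. (1/2) *\<^sub>R (d + w)) ` W)"
  defines "P \<equiv> central_proj cb H'"
  assumes data: "scal_data d W A"
    and sup: "superpotential d W A C F"
    and CH: "C \<subseteq> Hplane d"
    and cbC: "cb \<in> C"
    and cb_vertex: "cb extreme_point_of (convex hull C)"
    and cb_null: "is_null d cb"
    and sep: "\<exists>a b. H' = {y \<in> Hplane d. a \<bullet> y = b} \<and> a \<bullet> cb < b \<and> (\<forall>z\<in>K. b < a \<bullet> z)"
    and xi_vertex: "\<xi>b extreme_point_of (P ` K)"
  shows
    "(let c1A = (Jform d cb \<xi>b = 0);
          c1B = (\<exists>xb. K \<inter> affine hull {cb, \<xi>b} = {xb} \<and>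
                      (\<exists>ab\<in>C. is_null d ab \<and> (1/2) *\<^sub>R (ab + cb) = xb));
          c2 = (Jform d cb \<xi>b \<noteq> 0 \<and>
                (\<exists>vb wb. vb \<noteq> wb \<and> closed_segment vb wb face_of K \<and>
                         collinear {cb, \<xi>b, vb, wb}))
      in ((c1A \<or> c1B \<or> c2) \<and> \<not> (c1A \<and> c1B) \<and> \<not> (c1A \<and> c2) \<and> \<not> (c1B \<and> c2)) \<and>
         (c1A \<longrightarrow> (\<forall>z\<in>K. P z = \<xi>b \<longrightarrow> Jform d cb z = 0)) \<and>
         (\<forall>vb wb. vb \<noteq> wb \<and> closed_segment vb wb face_of K \<and> collinear {cb, \<xi>b, vb, wb} \<longrightarrow>
             closed_segment (2 *\<^sub>R vb - d) (2 *\<^sub>R wb - d) face_of convex hull W \<and>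
             collinear {2 *\<^sub>R cb - d, 2 *\<^sub>R \<xi>b - d, 2 *\<^sub>R vb - d, 2 *\<^sub>R wb - d}))"
proof -
  define V where "V = (\<lambda>w. (1/2) *\<^sub>R (d + w)) ` W"
  have K: "K = convex hull V" by (simp add: K_def V_def)
  have finW: "finite W" and d1: "\<And>i. d $ i \<ge> 1" and A: "\<And>w. w \<in> W \<Longrightarrow> A w \<noteq> 0"
    and ty: "\<And>w. w \<in> W \<Longrightarrow> typeI w \<or> typeII w \<or> typeIII w"
    using data by (auto simp: scal_data_def)
  have d_pos: "d $ i > 0" for i using d1[of i] by simp
  have finC: "finite C" using sup by (simp add: superpotential_def)
  obtain h b where H': "H' = {y \<in> Hplane d. h \<bullet> y = b}" and hc: "h \<bullet> cb < b"
    and hK: "\<And>z. z \<in> K \<Longrightarrow> b < h \<bullet> z" using sep by blast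
  have cH: "cb \<in> Hplane d" using CH cbC by blast
  have cK: "cb \<notin> K" using hc hK by fastforce
  \<comment> \<open>Two functionals are at work: \<open>h\<close> describes the projection
    \<open>P\<close> of \<open>K\<close>, while \<open>\<psi>\<close> is positive on all of
    \<open>C\<close> except at \<open>cb\<close> and controls the rays through points of
    \<open>C\<close>.\<close>
  obtain \<psi> where \<psi>: "\<And>p. p \<in> C \<Longrightarrow> p \<noteq> cb \<Longrightarrow> \<psi> \<bullet> (p - cb) > 0"
    using extreme_point_supporting[OF finC cb_vertex] by blast
  interpret null_vertex d W C A F cb \<psi> V "(\<lambda>p. persp \<psi> (p - cb)) ` (C - {cb})"
    using d_pos A sup CH cbC cb_null \<psi> cK by unfold_locales (auto simp: K V_def)
  have D: "D = (\<lambda>z. z - cb) ` K" by (simp add: D_def K)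
  have hD: "h \<bullet> x > 0" if "x \<in> D" for x
  proof -
    obtain z where "z \<in> K" "x = z - cb" using \<open>x \<in> D\<close> unfolding D by blast
    then show ?thesis using hK[of z] hc by (simp add: inner_diff_right)
  qed
  have "convex (Hplane d)"
  proof (rule convexI)
    fix x y and u v :: real assume xy: "x \<in> Hplane d" "y \<in> Hplane d" and "u + v = 1"
    from xy have "vsum (u *\<^sub>R x + v *\<^sub>R y) = (u + v) * ((ntot d - 1) / 2)"
      by (simp only: Hplane_def mem_Collect_eq vsum_simps distrib_right)
    then show "u *\<^sub>R x + v *\<^sub>R y \<in> Hplane d" using \<open>u + v = 1\<close> by (simp add: Hplane_def)
  qed
  moreover have "V \<subseteq> Hplane d"
    using vsum_scal_weight[OF ty] by (auto simp: V_def Hplane_def ntot_def)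
  ultimately have KH: "K \<subseteq> Hplane d" by (simp add: K hull_minimal)
  \<comment> \<open>On \<open>K\<close> the map \<open>P\<close> is \<open>persp h\<close> on
    \<open>D\<close>, scaled by \<open>\<beta>\<close> and translated by \<open>cb\<close>, so the
    vertex \<open>\<xi>b\<close> yields an extreme point of the slice of the cone.\<close>
  define \<beta> where "\<beta> = b - h \<bullet> cb"
  have \<beta>: "\<beta> > 0" using hc by (simp add: \<beta>_def)
  have P: "P z = cb + \<beta> *\<^sub>R persp h (z - cb)" if "z \<in> K" for z
    unfolding P_def \<beta>_def using KH that hK hc cH by (intro central_proj_eq[OF H']) auto
  obtain x0 where x0: "x0 \<in> K" "P x0 = \<xi>b"
    using xi_vertex by (auto simp: extreme_point_of_def)
  define e where "e = x0 - cb"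
  have eD: "e \<in> D" using x0 by (auto simp: D e_def)
  have "P ` K = (\<lambda>x. cb + \<beta> *\<^sub>R x) ` persp h ` D"
    unfolding D image_image using P by (intro image_cong) auto
  moreover have \<xi>_persp: "\<xi>b = cb + \<beta> *\<^sub>R persp h e" using P[OF x0(1)] x0(2) by (simp add: e_def)
  ultimately have "cb + \<beta> *\<^sub>R persp h e extreme_point_of (\<lambda>x. cb + \<beta> *\<^sub>R x) ` persp h ` D"
    using xi_vertex by simp
  then have ext: "persp h e extreme_point_of persp h ` D"
    by (rule extreme_point_of_affine_image[rotated]) (use \<beta> in simp)
  define r where "r = \<beta> / (h \<bullet> e)"
  have r: "r > 0" using \<beta> hD[OF eD] by (simp add: r_def)
  have \<xi>: "\<xi>b = cb + r *\<^sub>R e" by (simp add: \<xi>_persp r_def persp_def)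
  have e0: "e \<noteq> 0" using hD[OF eD] by auto
  have c\<xi>: "cb \<noteq> \<xi>b" using r e0 by (simp add: \<xi>)
  define L where "L = affine hull {cb, \<xi>b}"
  have L_iff: "z \<in> L \<longleftrightarrow> (\<exists>t. z = cb + t *\<^sub>R e)" for z
  proof -
    have "cb + t *\<^sub>R e = cb + (t / r) *\<^sub>R (cb + r *\<^sub>R e - cb)" for t using r by simp
    moreover have "cb + t *\<^sub>R (cb + r *\<^sub>R e - cb) = cb + (t * r) *\<^sub>R e" for t by simp
    ultimately show ?thesis unfolding L_def affine_hull_pair \<xi> image_iff by blast
  qed
  have x0L: "x0 \<in> L" unfolding L_iff by (rule exI[of _ 1]) (simp add: e_def)
  \<comment> \<open>Within \<open>K\<close>, the line \<open>L\<close> is exactly the fibre of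
    \<open>P\<close> over \<open>\<xi>b\<close>; the apex is excluded because \<open>h\<close> is
    positive on \<open>D\<close>.\<close>
  have L_persp: "z \<in> L \<longleftrightarrow> persp h (z - cb) = persp h e" if "z \<in> K" for z
  proof
    assume "z \<in> L"
    then obtain t where t: "z = cb + t *\<^sub>R e" using L_iff by blast
    have "z - cb \<in> D" using that by (simp add: D)
    then have "t \<noteq> 0" using hD t by force
    then show "persp h (z - cb) = persp h e" by (simp add: t persp_scaleR)
  next
    assume eq: "persp h (z - cb) = persp h e"
    have "z - cb \<in> D" using that by (simp add: D)
    then have "z - cb = (h \<bullet> (z - cb)) *\<^sub>R persp h e"
      using hD[of "z - cb"] unfolding eq[symmetric] by (simp add: scaleR_inner_persp)
    then have "z = cb + (h \<bullet> (z - cb) / (h \<bullet> e)) *\<^sub>R e" by (simp add: persp_def diff_eq_eq add.commute)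
    then show "z \<in> L" using L_iff by blast
  qed
  have JL: "Jform d cb z = 0" if "Jform d cb \<xi>b = 0" "z \<in> L" for z
    using that cb_null r by (auto simp: L_iff \<xi> Jform_simps is_null_def)
  \<comment> \<open>The fibre over a vertex is a face: if an inner point of a segment in
    \<open>K\<close> projects to the vertex, so do both ends.\<close>
  have face: "K \<inter> L face_of K"
    unfolding face_of_def
  proof (intro conjI ballI impI)
    show "convex (K \<inter> L)" by (simp add: K L_def convex_Int affine_imp_convex)
    fix z1 z2 z assume z12: "z1 \<in> K" "z2 \<in> K" and z: "z \<in> K \<inter> L" and seg: "z \<in> open_segment z1 z2"
    obtain u where u: "0 < u" "u < 1" "z = (1 - u) *\<^sub>R z1 + u *\<^sub>R z2"
      using seg by (auto simp: in_segment)
    have eq: "1 *\<^sub>R (z - cb) = (1 - u) *\<^sub>R (z1 - cb) + u *\<^sub>R (z2 - cb)"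
      by (simp add: u(3) scaleR_diff_right scaleR_diff_left)
    then have "persp h (z1 - cb) = persp h e \<and> persp h (z2 - cb) = persp h e"
      using z12 u(1,2) z L_persp[of z]
      by (intro extreme_persp_ray[OF ext hD _ _ _ _ _ _ eq]) (auto simp: D)
    then show "z1 \<in> K \<inter> L" "z2 \<in> K \<inter> L" using z12 L_persp by auto
  qed simp
  have L_collinear: "v \<in> L \<and> w \<in> L" if "collinear {cb, \<xi>b, v, w}" for v w
    unfolding L_def using that c\<xi>
    by (auto intro!: collinear_3_imp_in_affine_hull elim: collinear_subset)
  define c1B where "c1B \<longleftrightarrow> (\<exists>xb. K \<inter> L = {xb} \<and> (\<exists>ab\<in>C. is_null d ab \<and> (1/2) *\<^sub>R (ab + cb) = xb))"
  define edge where "edge \<longleftrightarrow> (\<exists>vb wb. vb \<noteq> wb \<and> closed_segment vb wb face_of K \<and>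
      collinear {cb, \<xi>b, vb, wb})"
  \<comment> \<open>The fibre is either the single point \<open>x0\<close> or a nondegenerate
    segment. In the first case every point of \<open>V\<close> on the ray equals \<open>x0\<close>,
    as \<open>null_reflection\<close> requires.\<close>
  have "c1B" if J: "Jform d cb \<xi>b \<noteq> 0" and single: "K \<inter> L = {x0}"
  proof -
    define y where "y = persp \<psi> e"
    interpret null_vertex_ray d W C A F cb \<psi> V "(\<lambda>p. persp \<psi> (p - cb)) ` (C - {cb})" y
      using extreme_point_hull_Y[OF hD ext eD] by unfold_locales (auto simp: V_def y_def)
    have VL: "cb + s *\<^sub>R y = x0" if "cb + s *\<^sub>R y \<in> V" for s
    proof -
      have "cb + s *\<^sub>R y \<in> L" unfolding L_iff y_def persp_def by auto
      moreover have "cb + s *\<^sub>R y \<in> K" using that by (simp add: K hull_inc)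
      ultimately show ?thesis using single by blast
    qed
    have "Jform d cb e \<noteq> 0" using J cb_null by (auto simp: \<xi> Jform_simps is_null_def)
    then have "Jform d cb y \<noteq> 0"
      using \<psi>_pos_D[OF eD] by (simp add: y_def persp_def Jform_simps)
    moreover have "s = t" if "cb + s *\<^sub>R y \<in> V" "cb + t *\<^sub>R y \<in> V" for s t
      using VL[OF that(1)] VL[OF that(2)] y_ne by (metis add_left_cancel scaleR_cancel_right)
    ultimately obtain a s where "a \<in> C" "is_null d a" "cb + s *\<^sub>R y \<in> V"
      "(1/2) *\<^sub>R (a + cb) = cb + s *\<^sub>R y"
      using null_reflection by metis
    then show ?thesis using VL single unfolding c1B_def by metis
  qed
  \<comment> \<open>A compact convex subset of a line is a segment. It is a face of
    \<open>K\<close>, and its ends differ because it contains \<open>x0\<close> and more.\<close>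
  moreover have edge if "K \<inter> L \<noteq> {x0}"
  proof -
    have "closed L" by (simp add: L_def)
    moreover have "compact K" using finW by (simp add: K V_def finite_imp_compact_convex_hull)
    ultimately have comp: "compact (K \<inter> L)" by (rule compact_Int_closed[rotated])
    have coll: "collinear (K \<inter> L)"
      unfolding collinear_affine_hull L_def by blast
    have x0KL: "x0 \<in> K \<inter> L" using x0 x0L by simp
    then have "K \<inter> L \<noteq> {}" by blast
    then obtain v w where vw: "K \<inter> L = closed_segment v w"
      by (rule compact_convex_collinear_segment[OF _ comp face_of_imp_convex[OF face] coll])
    then have "v \<noteq> w" using vw that x0KL by auto
    moreover have "{cb, \<xi>b, v, w} \<subseteq> L"
      using vw ends_in_segment[of v w] by (auto simp: L_def intro: hull_inc)
    then have "collinear {cb, \<xi>b, v, w}" unfolding collinear_affine_hull L_def by blast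
    ultimately show edge unfolding edge_def using face vw by metis
  qed
  \<comment> \<open>Orthogonality of \<open>cb\<close> to the midpoint makes the null vectors
    \<open>cb\<close> and \<open>a\<close> orthogonal, hence equal; the midpoint would then be
    \<open>cb\<close>, which is not in \<open>K\<close>.\<close>
  moreover have "\<not> c1B" if "Jform d cb \<xi>b = 0"
  proof
    assume c1B
    then obtain x a where x: "x \<in> K \<inter> L" "a \<in> C" "is_null d a" "(1/2) *\<^sub>R (a + cb) = x"
      unfolding c1B_def by blast
    have "Jform d cb x = 0" using JL[OF that] x by blast
    then have "Jform d cb a = 0"
      using cb_null by (simp add: x(4)[symmetric] Jform_simps is_null_def)
    then have "cb = a" using x cbC cb_null null_eqI by blast
    then have "x = cb" using x(4) by (simp flip: scaleR_2)
    then show False using x cK by blast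
  qed
  \<comment> \<open>The ends of such an edge are two distinct points of \<open>K\<close> on
    \<open>L\<close>.\<close>
  moreover have "\<not> edge" if c1B
  proof
    assume edge
    then obtain v w where vw: "v \<noteq> w" "closed_segment v w face_of K" "collinear {cb, \<xi>b, v, w}"
      unfolding edge_def by blast
    then have "v \<in> K \<inter> L" "w \<in> K \<inter> L"
      using L_collinear[OF vw(3)] face_of_imp_subset[OF vw(2)] by auto
    then show False using vw(1) that unfolding c1B_def by (metis singletonD)
  qed
  moreover have "\<forall>z\<in>K. P z = \<xi>b \<longrightarrow> Jform d cb z = 0" if "Jform d cb \<xi>b = 0"
  proof (intro ballI impI)
    fix z assume z: "z \<in> K" "P z = \<xi>b"
    then have "persp h (z - cb) = persp h e"
      using P[OF z(1)] P[OF x0(1)] x0(2) \<beta> by (simp add: e_def)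
    then show "Jform d cb z = 0" using JL[OF that] L_persp z by blast
  qed
  moreover have "closed_segment (2 *\<^sub>R vb - d) (2 *\<^sub>R wb - d) face_of convex hull W \<and>
      collinear {2 *\<^sub>R cb - d, 2 *\<^sub>R \<xi>b - d, 2 *\<^sub>R vb - d, 2 *\<^sub>R wb - d}"
    if "closed_segment vb wb face_of K" "collinear {cb, \<xi>b, vb, wb}" for vb wb
    using face_of_hull_rescale[of vb wb d W] collinear_rescale[OF that(2), of d] that(1)
    by (simp add: K_def)
  ultimately show ?thesis
    unfolding Let_def L_def[symmetric] c1B_def[symmetric] edge_def[symmetric] by blast
qed

end
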